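(* Let $\mathfrak{v}=\{\nu_i\}_{i\in I}$ be a totally ordered subset of $\mathcal{V}$, and suppose there exists $\nu\in\mathcal{V}$ such that $\nu_i\le\nu$ for every $i\in I$. Let $R$ be the additive subgroup of $\mathcal{G}_\nu$ generated by the set $\{\mathrm{in}_\nu(f)\mid f\in\mathbb{K}[x] \text{ is } \mathfrak{v}\text{-stable}\}$ (it is a subring of $\mathcal{G}_\nu$). Then, as commutative rings with unity, $$\varinjlim \mathcal{G}_{\nu_i}\cong R,$$ where the direct limit is that of the direct system $\{(\mathcal{G}_{\nu_i},\phi_{ij})\}_{i\le j}^{i,j\in I}$.
   Context: A valuation on a commutative ring $A$ with unity is a map $\nu:A\to\Gamma_\infty=\Gamma\cup\{\infty\}$, with $\Gamma$ a totally ordered abelian group, such that $\nu(ab)=\nu(a)+\nu(b)$, $\nu(a+b)\ge\min\{\nu(a),\nu(b)\}$, $\nu(1)=0$, $\nu(0)=\infty$. Its support is $\mathrm{supp}(\nu)=\{a\mid\nu(a)=\infty\}$, which may be non-zero. Let $\mathbb{K}$ be a field, $\nu_0$ a valuation on $\mathbb{K}$ with support $\{0\}$ and value group $\Gamma_0$, and fix a totally ordered divisible abelian group $\Gamma\supseteq\Gamma_0$. Put $\mathcal{V}=\{\nu_0\}\cup\{\nu:\mathbb{K}[x]\to\Gamma_\infty\mid \nu\text{ is a valuation extending }\nu_0\}$, partially ordered by $\nu_0\le\nu$ for all $\nu\in\mathcal{V}$, and, for $\nu,\mu\in\mathcal{V}\setminus\{\nu_0\}$, $\nu\le\mu$ iff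 $\nu(f)\le\mu(f)$ for all $f\in\mathbb{K}[x]$. The families $\mathfrak{v}=\{\nu_i\}_{i\in I}$ considered are non-empty and consist of valuations on $\mathbb{K}[x]$; $I$ carries the induced total order ($i\le j$ iff $\nu_i\le\nu_j$). The valuation $\nu$ is also a valuation on $\mathbb{K}[x]$. A polynomial $f\in\mathbb{K}[x]$ is $\mathfrak{v}$-stable if there is $i_f\in I$ with $\nu_i(f)=\nu_{i_f}(f)$ for every $i\in I$ with $i\ge i_f$. Graded ring: for a valuation $\nu$ on $\mathbb{K}[x]$ and $\gamma\in\nu(\mathbb{K}[x]\setminus\mathrm{supp}(\nu))$ let $\mathcal{P}_\gamma=\{f\mid\nu(f)\ge\gamma\}$, $\mathcal{P}_\gamma^+=\{f\mid\nu(f)>\gamma\}$; then $\mathcal{G}_\nu=\bigoplus_\gamma\mathcal{P}_\gamma/\mathcal{P}_\gamma^+$, with product extending $(f+\mathcal{P}_\beta^+)(g+\mathcal{P}_\gamma^+)=fg+\mathcal{P}_{\beta+\gamma}^+$ for $\nu(f)=\beta$, $\nu(g)=\gamma$. For $f\notin\mathrm{supp}(\nu)$, $\mathrm{in}_\nu(f)$ is the image of $f$ in $\mathcal{P}_{\nu(f)}/\mathcal{P}_{\nu(f)}^+$; for $f\in\mathrm{supp}(\nu)$, $\mathrm{in}_\nu(f)=0$. For $i\le j$, $\phi_{ij}:\mathcal{G}_{\nu_i}\to\mathcal{G}_{\nu_j}$ is the (well-defined) ring homomorphism obtained by additive extension from $\mathrm{in}_{\nu_i}(f)\mapsto\mathrm{in}_{\nu_j}(f)$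 if $\nu_i(f)=\nu_j(f)$ and $\mathrm{in}_{\nu_i}(f)\mapsto0$ if $\nu_i(f)<\nu_j(f)$. These maps form a direct system over $I$.
   Formalization: Added hypothesis: if the family has a largest element, that element is ν. Without it the claim fails: over trivially valued K, take the trivial valuation on K[x] as the only member and ν with support (x); the limit is K[x] but R = K. *)

theory Defs
  imports
    "HOL-Algebra.Product_Groups"
    "HOL-Algebra.Generated_Groups"
    "HOL-Algebra.RingHom"
    "HOL-Algebra.Subrings"
    "HOL-Computational_Algebra.Polynomial"
begin

section \<open>Totally ordered divisible abelian groups with a point at infinity\<close>

class divisible_linordered_ab_group_add = linordered_ab_group_add +
  assumes divisible: "0 < n \<Longrightarrow> \<exists>b. (\<Sum>i<(n::nat). b) = a"

datatype 'g with_infinity = Fin 'g | Infinity (\<open>\<infinity>\<close>)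

instantiation with_infinity :: (linorder) linorder
begin

fun less_eq_with_infinity :: "'a with_infinity \<Rightarrow> 'a with_infinity \<Rightarrow> bool" where
  "Fin a \<le> Fin b \<longleftrightarrow> a \<le> b"
| "_ \<le> \<infinity> \<longleftrightarrow> True"
| "\<infinity> \<le> Fin b \<longleftrightarrow> False"

definition less_with_infinity :: "'a with_infinity \<Rightarrow> 'a with_infinity \<Rightarrow> bool" where
  "x < y \<longleftrightarrow> x \<le> y \<and> \<not> y \<le> (x :: 'a with_infinity)"

instance
proof
  fix x y z :: "'a with_infinity"
  show "x < y \<longleftrightarrow> x \<le> y \<and> \<not> y \<le> x"
    by (rule less_with_infinity_def)
  show "x \<le> x"
    by (cases x) auto
  show "x \<le> y \<Longrightarrow> y \<le> z \<Longrightarrow> x \<le> z"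
    by (cases x; cases y; cases z) auto
  show "x \<le> y \<Longrightarrow> y \<le> x \<Longrightarrow> x = y"
    by (cases x; cases y) auto
  show "x \<le> y \<or> y \<le> x"
    by (cases x; cases y) auto
qed

end

instantiation with_infinity :: (plus) plus
begin

fun plus_with_infinity :: "'a with_infinity \<Rightarrow> 'a with_infinity \<Rightarrow> 'a with_infinity" where
  "Fin a + Fin b = Fin (a + b)"
| "_ + \<infinity> = \<infinity>"
| "\<infinity> + Fin b = \<infinity>"

instance ..

end


section \<open>Valuations\<close>

definition valuation :: "('a::comm_ring_1 \<Rightarrow> 'g::linordered_ab_group_add with_infinity) \<Rightarrow> bool" where
  "valuation v \<longleftrightarrow>
     (\<forall>a b. v (a * b) = v a + v b) \<and>
     (\<forall>a b. v (a + b) \<ge> min (v a) (v b)) \<and>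
     v 1 = Fin 0 \<and> v 0 = \<infinity>"

definition supp :: "('a \<Rightarrow> 'g with_infinity) \<Rightarrow> 'a set" where
  "supp v = {a. v a = \<infinity>}"

definition extensions ::
  "('k::field \<Rightarrow> 'g::linordered_ab_group_add with_infinity) \<Rightarrow> ('k poly \<Rightarrow> 'g with_infinity) set" where
  "extensions v0 = {v. valuation v \<and> (\<forall>c. v [:c:] = v0 c)}"

text \<open>
  A family of valuations is given as a set \<open>V\<close>, indexed by its own elements. The order on
  valuations, \<open>v \<le> w\<close> iff \<open>v f \<le> w f\<close> for all \<open>f\<close>, is the library order on functions.
\<close>

definition stable :: "('a \<Rightarrow> 'g::linordered_ab_group_add with_infinity) set \<Rightarrow> 'a \<Rightarrow> bool" where
  "stable V f \<longleftrightarrow> (\<exists>v\<in>V. \<forall>w\<in>V. v \<le> w \<longrightarrow> w f = v f)"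


text \<open>
  Pitfall: if \<open>V\<close> has a largest element then every element is stable, whatever its value under an
  upper bound \<open>v\<close> of \<open>V\<close>. For instance let \<open>V\<close> consist of the trivial valuation of \<open>k[x]\<close> only, and
  let \<open>v f\<close> be \<open>0\<close> or \<open>\<infinity>\<close> according to whether \<open>f(0) \<noteq> 0\<close> or \<open>f(0) = 0\<close>: the direct limit of the
  graded rings of \<open>V\<close> is \<open>k[x]\<close>, but the graded ring of \<open>v\<close> is \<open>k\<close>. Hence results comparing the
  two need that \<open>V\<close> has no largest element, or that \<open>v\<close> is the largest element.
\<close>


section \<open>The graded ring of a valuation\<close>

text \<open>The index set of the grading: the finite values, i.e. those attained outside \<^const>\<open>supp\<close>.\<close>

definition finite_values :: "('a \<Rightarrow> 'g with_infinity) \<Rightarrow> 'g set" where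
  "finite_values v = {\<gamma>. \<exists>f. f \<notin> supp v \<and> v f = Fin \<gamma>}"

definition val_ge :: "('a \<Rightarrow> 'g::linorder with_infinity) \<Rightarrow> 'g \<Rightarrow> 'a set" where
  "val_ge v \<gamma> = {f. v f \<ge> Fin \<gamma>}"

definition val_gt :: "('a \<Rightarrow> 'g::linorder with_infinity) \<Rightarrow> 'g \<Rightarrow> 'a set" where
  "val_gt v \<gamma> = {f. v f > Fin \<gamma>}"

definition val_ge_group :: "('a::comm_ring_1 \<Rightarrow> 'g::linorder with_infinity) \<Rightarrow> 'g \<Rightarrow> 'a monoid" where
  "val_ge_group v \<gamma> = \<lparr>carrier = val_ge v \<gamma>, monoid.mult = (+), one = 0\<rparr>"

text \<open>The additive group \<open>P\<^sub>\<gamma> / P\<^sub>\<gamma>\<^sup>+\<close>, in multiplicative notation.\<close>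

definition component :: "('a::comm_ring_1 \<Rightarrow> 'g::linorder with_infinity) \<Rightarrow> 'g \<Rightarrow> 'a set monoid" where
  "component v \<gamma> = val_ge_group v \<gamma> Mod val_gt v \<gamma>"

definition residue ::
  "('a::comm_ring_1 \<Rightarrow> 'g::linorder with_infinity) \<Rightarrow> 'g \<Rightarrow> 'a \<Rightarrow> 'a set" where
  "residue v \<gamma> f = val_gt v \<gamma> #>\<^bsub>val_ge_group v \<gamma>\<^esub> f"

text \<open>
  The product of a residue class of degree \<open>\<beta>\<close> and one of degree \<open>\<gamma>\<close>. The union is over
  representatives; all of them give the same class (compare \<open>rcoset_mult\<close>).
\<close>

definition residue_mult ::
  "('a::comm_ring_1 \<Rightarrow> 'g::linordered_ab_group_add with_infinity) \<Rightarrow> 'g \<Rightarrow> 'g \<Rightarrow> 'a set \<Rightarrow> 'a set \<Rightarrow> 'a set" where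
  "residue_mult v \<beta> \<gamma> A B = (\<Union>f\<in>A. \<Union>g\<in>B. residue v (\<beta> + \<gamma>) (f * g))"

definition degrees ::
  "('a::comm_ring_1 \<Rightarrow> 'g::linorder with_infinity) \<Rightarrow> ('g \<Rightarrow> 'a set) \<Rightarrow> 'g set" where
  "degrees v x = {\<gamma> \<in> finite_values v. x \<gamma> \<noteq> \<one>\<^bsub>component v \<gamma>\<^esub>}"

text \<open>For \<open>f\<close> in the support every component is trivial, so that the initial form is zero.\<close>

definition initial_form ::
  "('a::comm_ring_1 \<Rightarrow> 'g::linorder with_infinity) \<Rightarrow> 'a \<Rightarrow> 'g \<Rightarrow> 'a set" where
  "initial_form v f =
     (\<lambda>\<gamma>\<in>finite_values v. if v f = Fin \<gamma> then residue v \<gamma> f else \<one>\<^bsub>component v \<gamma>\<^esub>)"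

text \<open>
  The underlying additive group is the direct sum \<^const>\<open>sum_group\<close>. In the product the component
  of degree \<open>\<delta>\<close> is the (finite) sum in \<open>P\<^sub>\<delta> / P\<^sub>\<delta>\<^sup>+\<close> of the products of the components of degrees
  \<open>\<beta>\<close> and \<open>\<gamma>\<close> with \<open>\<beta> + \<gamma> = \<delta>\<close>; it appears as a \<^const>\<open>finprod\<close> because
  \<^const>\<open>component\<close> is written multiplicatively.
\<close>

definition graded_ring ::
  "('a::comm_ring_1 \<Rightarrow> 'g::linordered_ab_group_add with_infinity) \<Rightarrow> ('g \<Rightarrow> 'a set) ring" where
  "graded_ring v =
     \<lparr>carrier = carrier (sum_group (finite_values v) (component v)),
      monoid.mult = (\<lambda>x y. \<lambda>\<delta>\<in>finite_values v.
        finprod (component v \<delta>) (\<lambda>(\<beta>, \<gamma>). residue_mult v \<beta> \<gamma> (x \<beta>) (y \<gamma>))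
          {(\<beta>, \<gamma>). \<beta> \<in> degrees v x \<and> \<gamma> \<in> degrees v y \<and> \<beta> + \<gamma> = \<delta>}),
      one = initial_form v 1,
      zero = \<one>\<^bsub>sum_group (finite_values v) (component v)\<^esub>,
      add = monoid.mult (sum_group (finite_values v) (component v))\<rparr>"

text \<open>
  The transition map: a non-zero homogeneous component of \<open>x\<close> is the initial form of any of its
  representatives \<open>f\<close>; it is sent to the initial form of \<open>f\<close> with respect to \<open>w\<close> if the two values
  agree and to zero otherwise, and the images are added up. For valuations \<open>v \<le> w\<close> the result does
  not depend on the chosen representatives.
\<close>

definition graded_map ::
  "('a::comm_ring_1 \<Rightarrow> 'g::linordered_ab_group_add with_infinity) \<Rightarrow> ('a \<Rightarrow> 'g with_infinity) \<Rightarrow>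
   ('g \<Rightarrow> 'a set) \<Rightarrow> ('g \<Rightarrow> 'a set)" where
  "graded_map v w x =
     (\<Oplus>\<^bsub>graded_ring w\<^esub>\<gamma>\<in>degrees v x.
        let f = (SOME f. f \<in> x \<gamma>)
        in if v f = w f then initial_form w f else \<zero>\<^bsub>graded_ring w\<^esub>)"


section \<open>Direct limits of rings\<close>

text \<open>
  The direct limit of a direct system \<open>(G i, \<phi> i j)\<close> over \<open>I\<close>, as the quotient of the disjoint
  union of the carriers by the relation identifying \<open>(i, x)\<close> and \<open>(j, y)\<close> when they have the same
  image in some \<open>G k\<close> with \<open>i, j \<le> k\<close>. The unions in the operations are over representatives; for
  a direct system over a non-empty directed \<open>I\<close> all of them give the same class.
\<close>

definition direct_limit_rel ::
  "'i::ord set \<Rightarrow> ('i \<Rightarrow> ('a, 'm) ring_scheme) \<Rightarrow> ('i \<Rightarrow> 'i \<Rightarrow> 'a \<Rightarrow> 'a) \<Rightarrow> (('i \<times> 'a) \<times> ('i \<times> 'a)) set" where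
  "direct_limit_rel I G \<phi> =
     {((i, x), (j, y)). i \<in> I \<and> x \<in> carrier (G i) \<and> j \<in> I \<and> y \<in> carrier (G j) \<and>
        (\<exists>k\<in>I. i \<le> k \<and> j \<le> k \<and> \<phi> i k x = \<phi> j k y)}"

definition direct_limit_class ::
  "'i::ord set \<Rightarrow> ('i \<Rightarrow> ('a, 'm) ring_scheme) \<Rightarrow> ('i \<Rightarrow> 'i \<Rightarrow> 'a \<Rightarrow> 'a) \<Rightarrow> 'i \<Rightarrow> 'a \<Rightarrow> ('i \<times> 'a) set" where
  "direct_limit_class I G \<phi> i x = direct_limit_rel I G \<phi> `` {(i, x)}"

definition direct_limit ::
  "'i::ord set \<Rightarrow> ('i \<Rightarrow> ('a, 'm) ring_scheme) \<Rightarrow> ('i \<Rightarrow> 'i \<Rightarrow> 'a \<Rightarrow> 'a) \<Rightarrow> ('i \<times> 'a) set ring" where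
  "direct_limit I G \<phi> =
     \<lparr>carrier = (SIGMA i:I. carrier (G i)) // direct_limit_rel I G \<phi>,
      monoid.mult = (\<lambda>X Y. \<Union>(i, x)\<in>X. \<Union>(j, y)\<in>Y. \<Union>k\<in>{k \<in> I. i \<le> k \<and> j \<le> k}.
        direct_limit_class I G \<phi> k (\<phi> i k x \<otimes>\<^bsub>G k\<^esub> \<phi> j k y)),
      one = (\<Union>i\<in>I. direct_limit_class I G \<phi> i \<one>\<^bsub>G i\<^esub>),
      zero = (\<Union>i\<in>I. direct_limit_class I G \<phi> i \<zero>\<^bsub>G i\<^esub>),
      add = (\<lambda>X Y. \<Union>(i, x)\<in>X. \<Union>(j, y)\<in>Y. \<Union>k\<in>{k \<in> I. i \<le> k \<and> j \<le> k}.
        direct_limit_class I G \<phi> k (\<phi> i k x \<oplus>\<^bsub>G k\<^esub> \<phi> j k y))\<rparr>"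


section \<open>The subring generated by the initial forms of stable elements\<close>

definition stable_subring ::
  "('a::comm_ring_1 \<Rightarrow> 'g::linordered_ab_group_add with_infinity) set \<Rightarrow> ('a \<Rightarrow> 'g with_infinity) \<Rightarrow>
   ('g \<Rightarrow> 'a set) set" where
  "stable_subring V v = generate (add_monoid (graded_ring v)) {initial_form v f | f. stable V f}"

end

theory Submission
  imports Defs "HOL-Library.Poly_Mapping"
begin

text \<open>
  A graded ring is awkward to compute in, because the components of a product are sums over pairs of
  degrees of cosets. Everything is therefore lifted to the group algebra \<open>A[t\<^sup>\<Gamma>]\<close>, realised as
  finitely supported functions on the value group. For a valuation \<open>v\<close> let \<open>S\<^sub>v\<close> (\<open>rees_algebra\<close>) be the
  subring of the sums \<open>\<Sum> f\<^sub>\<gamma> t\<^sup>\<gamma>\<close> with \<open>v f\<^sub>\<gamma> \<ge> \<gamma>\<close>, and \<open>I\<^sub>v\<close> (\<open>rees_ideal\<close>) its ideal given by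
  \<open>v f\<^sub>\<gamma> > \<gamma>\<close>. The graded ring of \<open>v\<close> is \<open>S\<^sub>v / I\<^sub>v\<close> (\<open>graded_ring_presentation\<close>). For \<open>v \<le> w\<close> one has
  \<open>S\<^sub>v \<subseteq> S\<^sub>w\<close> and \<open>I\<^sub>v \<subseteq> I\<^sub>w\<close>, and the transition map is the one induced by the inclusion
  (\<open>graded_map_graded_class\<close>).

  Let \<open>T\<close> (\<open>stable_rees_algebra\<close>) be the union of the \<open>S\<^sub>v\<close> for \<open>v\<close> in the chain \<open>V\<close>. The limit is the quotient of \<open>T\<close> by the
  union of the \<open>I\<^sub>v\<close>, and the image of \<open>T\<close> in the graded ring of \<open>\<nu>\<close> is the quotient of \<open>T\<close> by \<open>T \<inter> I\<^sub>\<nu>\<close>.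
  It remains to see that the two kernels agree and that this image is the stable subring. Both follow
  from one fact on stability: \<open>f\<close> is stable iff \<open>v f = \<nu> f\<close> for
  some \<open>v\<close> in \<open>V\<close>. Indeed, an unstable coefficient exceeds its degree already at some member of \<open>V\<close>
  and a stable one does so if its final value, which is \<open>\<nu> f\<close>, does; hence \<open>T \<inter> I\<^sub>\<nu>\<close> is the union of
  the \<open>I\<^sub>v\<close> (\<open>rees_ideal_before_limit\<close>). And the monomials of \<open>T\<close> map to zero or to initial forms of
  stable elements, so that the image of \<open>T\<close> is the stable subring (\<open>stable_subring_eq\<close>).

  The fact on stability is where polynomials over a field enter (\<open>stable_value_eq\<close>). If the values
  of \<open>f\<close> are constant from \<open>v\<close> on, then \<open>v f = w f\<close> for some \<open>v < w\<close> in \<open>V\<close>, unless \<open>v\<close> is the largest member and thus \<open>\<nu>\<close> itself.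
  The elements whose initial form is killed on passing from \<open>v\<close> to a larger valuation are
  governed by a single polynomial \<open>Q\<close> of least degree, through division by \<open>Q\<close>, and it is the same for
  \<open>w\<close> as for \<open>\<nu>\<close>; so what is not killed in \<open>w\<close> is never killed later (\<open>valuation_eq_upper_bound\<close>).
\<close>

section \<open>Rings presented as images\<close>

text \<open>
  The map \<open>c\<close> is a surjection from a subring \<open>S\<close> of the ambient type onto \<open>R\<close> that respects the
  operations. The ring axioms for \<open>R\<close> are inherited from \<open>S\<close>; this replaces computations with cosets
  and with classes in a direct limit.
\<close>

locale ring_presentation =
  fixes S :: "'a::comm_ring_1 set" and c :: "'a \<Rightarrow> 'b" and R :: "('b, 'm) ring_scheme" (structure)
  assumes zero_mem: "0 \<in> S" and one_mem: "1 \<in> S"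
    and add_mem: "\<And>x y. x \<in> S \<Longrightarrow> y \<in> S \<Longrightarrow> x + y \<in> S"
    and mult_mem: "\<And>x y. x \<in> S \<Longrightarrow> y \<in> S \<Longrightarrow> x * y \<in> S"
    and uminus_mem: "\<And>x. x \<in> S \<Longrightarrow> - x \<in> S"
    and carrier_eq: "carrier R = c ` S"
    and hom_zero: "\<zero> = c 0" and hom_one: "\<one> = c 1"
    and hom_add: "\<And>x y. x \<in> S \<Longrightarrow> y \<in> S \<Longrightarrow> c x \<oplus> c y = c (x + y)"
    and hom_mult: "\<And>x y. x \<in> S \<Longrightarrow> y \<in> S \<Longrightarrow> c x \<otimes> c y = c (x * y)"
begin

lemma presented_cring: "cring R"
proof (rule cringI)
  show "abelian_group R"
  proof (rule abelian_groupI)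
    show "\<exists>y\<in>carrier R. y \<oplus> x = \<zero>" if x: "x \<in> carrier R" for x
    proof -
      obtain a where "a \<in> S" "x = c a"
        using x carrier_eq by auto
      then have "c (- a) \<in> carrier R" "c (- a) \<oplus> x = \<zero>"
        using hom_add[of "- a" a] hom_zero uminus_mem carrier_eq by auto
      then show ?thesis by blast
    qed
  qed (auto simp: carrier_eq hom_zero hom_add zero_mem add_mem add.commute add.left_commute)
  show "comm_monoid R"
    by (rule comm_monoidI)
      (auto simp: carrier_eq hom_one hom_mult one_mem mult_mem mult.commute mult.left_commute)
  show "(x \<oplus> y) \<otimes> z = x \<otimes> z \<oplus> y \<otimes> z"
    if "x \<in> carrier R" "y \<in> carrier R" "z \<in> carrier R" for x y z
    using that by (auto simp: carrier_eq hom_add hom_mult add_mem mult_mem distrib_right)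
qed

lemma sum_mem: "(\<And>i. i \<in> A \<Longrightarrow> h i \<in> S) \<Longrightarrow> sum h A \<in> S"
  by (induction A rule: infinite_finite_induct) (auto simp: zero_mem add_mem)

lemma hom_finsum:
  assumes "finite A" and "\<And>i. i \<in> A \<Longrightarrow> h i \<in> S"
  shows "(\<Oplus>i\<in>A. c (h i)) = c (sum h A)"
proof -
  interpret cring R by (rule presented_cring)
  show ?thesis
    using assms
  proof (induction A rule: finite_induct)
    case empty
    then show ?case by (simp add: hom_zero)
  next
    case (insert a A)
    then have "(\<Oplus>i\<in>insert a A. c (h i)) = c (h a) \<oplus> (\<Oplus>i\<in>A. c (h i))"
      by (subst finsum_insert) (auto simp: carrier_eq)
    also have "\<dots> = c (h a) \<oplus> c (sum h A)"
      using insert by simp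
    also have "\<dots> = c (h a + sum h A)"
      using insert sum_mem[of A h] by (simp add: hom_add)
    finally show ?case
      using insert by simp
  qed
qed

end

text \<open>
  The first isomorphism theorem, with equality of the two kernels as the hypothesis.
\<close>

lemma presentations_iso:
  assumes "ring_presentation S c R" and "ring_presentation S d R'"
    and same: "\<And>x y. x \<in> S \<Longrightarrow> y \<in> S \<Longrightarrow> c x = c y \<longleftrightarrow> d x = d y"
  shows "R \<simeq> R'"
proof -
  interpret R: ring_presentation S c R by fact
  interpret R': ring_presentation S d R' by fact
  define h where "h X = d (inv_into S c X)" for X
  have h: "h (c x) = d x" if "x \<in> S" for x
    using that same[of "inv_into S c (c x)" x] inv_into_into[of "c x" c S] f_inv_into_f[of "c x" c S]
    by (auto simp: h_def)
  have "h \<in> ring_hom R R'"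
    by (rule ring_hom_memI)
      (auto simp: R.carrier_eq R'.carrier_eq R.hom_add R'.hom_add R.hom_mult R'.hom_mult
        R.hom_one R'.hom_one h R.add_mem R.mult_mem R.one_mem)
  moreover have "bij_betw h (carrier R) (carrier R')"
    unfolding bij_betw_def inj_on_def
    by (auto simp: R.carrier_eq R'.carrier_eq h same image_image)
  ultimately show ?thesis
    unfolding is_ring_iso_def ring_iso_def by blast
qed

section \<open>Valuations and their filtrations\<close>

lemma less_with_infinity_simps [simp]:
  fixes a b :: "'g::linorder"
  shows "Fin a < Fin b \<longleftrightarrow> a < b" and "Fin a < \<infinity>" and "\<not> \<infinity> < x"
  by (auto simp: less_with_infinity_def)

context
  fixes v :: "'a::comm_ring_1 \<Rightarrow> 'g::linordered_ab_group_add with_infinity"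
  assumes val: "valuation v"
begin

lemma valuation_mult: "v (a * b) = v a + v b"
  and valuation_add: "min (v a) (v b) \<le> v (a + b)"
  and valuation_one: "v 1 = Fin 0"
  and valuation_zero: "v 0 = \<infinity>"
  using val by (auto simp: valuation_def)

lemma valuation_uminus: "v (- a) = v a"
proof -
  have "v (- 1) + v (- 1) = Fin 0"
    using valuation_mult[of "- 1" "- 1"] valuation_one by simp
  then have "v (- 1) = Fin 0"
    by (cases "v (- 1)") auto
  then show ?thesis
    using valuation_mult[of "- 1" a] by (cases "v a") auto
qed

lemma valuation_diff: "min (v a) (v b) \<le> v (a - b)"
  using valuation_add[of a "- b"] valuation_uminus[of b] by simp

lemma zero_mem_val_ge: "0 \<in> val_ge v \<gamma>"
  by (simp add: val_ge_def valuation_zero)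

lemma zero_mem_val_gt: "0 \<in> val_gt v \<gamma>"
  by (simp add: val_gt_def valuation_zero)

lemma add_mem_val_ge: "f \<in> val_ge v \<gamma> \<Longrightarrow> g \<in> val_ge v \<gamma> \<Longrightarrow> f + g \<in> val_ge v \<gamma>"
  using valuation_add[of f g] by (auto simp: val_ge_def min_def split: if_splits)

lemma add_mem_val_gt: "f \<in> val_gt v \<gamma> \<Longrightarrow> g \<in> val_gt v \<gamma> \<Longrightarrow> f + g \<in> val_gt v \<gamma>"
  using valuation_add[of f g] by (auto simp: val_gt_def min_def split: if_splits)

lemma uminus_mem_val_ge: "f \<in> val_ge v \<gamma> \<Longrightarrow> - f \<in> val_ge v \<gamma>"
  by (simp add: val_ge_def valuation_uminus)

lemma uminus_mem_val_gt: "f \<in> val_gt v \<gamma> \<Longrightarrow> - f \<in> val_gt v \<gamma>"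
  by (simp add: val_gt_def valuation_uminus)

lemma val_gt_subset_val_ge: "val_gt v \<gamma> \<subseteq> val_ge v \<gamma>"
  by (auto simp: val_gt_def val_ge_def)

lemma diff_mem_val_gt: "f \<in> val_gt v \<gamma> \<Longrightarrow> g \<in> val_gt v \<gamma> \<Longrightarrow> f - g \<in> val_gt v \<gamma>"
  using add_mem_val_gt[of f \<gamma> "- g"] uminus_mem_val_gt[of g] by simp

lemma sum_mem_val_ge: "(\<And>i. i \<in> A \<Longrightarrow> h i \<in> val_ge v \<gamma>) \<Longrightarrow> sum h A \<in> val_ge v \<gamma>"
  by (induction A rule: infinite_finite_induct) (auto simp: zero_mem_val_ge add_mem_val_ge)

lemma sum_mem_val_gt: "(\<And>i. i \<in> A \<Longrightarrow> h i \<in> val_gt v \<gamma>) \<Longrightarrow> sum h A \<in> val_gt v \<gamma>"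
  by (induction A rule: infinite_finite_induct) (auto simp: zero_mem_val_gt add_mem_val_gt)

lemma mult_mem_val_ge:
  "f \<in> val_ge v \<beta> \<Longrightarrow> g \<in> val_ge v \<gamma> \<Longrightarrow> f * g \<in> val_ge v (\<beta> + \<gamma>)"
  by (cases "v f"; cases "v g") (auto simp: val_ge_def valuation_mult add_mono)

lemma mult_mem_val_gt:
  assumes "f \<in> val_gt v \<beta>" and "g \<in> val_ge v \<gamma>"
  shows "f * g \<in> val_gt v (\<beta> + \<gamma>)"
proof (cases "v f = \<infinity> \<or> v g = \<infinity>")
  case True
  then have "v (f * g) = \<infinity>"
    by (cases "v f"; cases "v g") (simp_all add: valuation_mult)
  then show ?thesis
    by (simp add: val_gt_def)
next
  case False
  then obtain a b where ab: "v f = Fin a" "v g = Fin b"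
    by (cases "v f"; cases "v g") auto
  then have "\<beta> < a" "\<gamma> \<le> b"
    using assms by (simp_all add: val_gt_def val_ge_def)
  then have "\<beta> + \<gamma> < a + b"
    by (rule add_less_le_mono)
  then show ?thesis
    using ab by (simp add: val_gt_def valuation_mult)
qed

lemma mult_mem_val_gt':
  "f \<in> val_ge v \<beta> \<Longrightarrow> g \<in> val_gt v \<gamma> \<Longrightarrow> f * g \<in> val_gt v (\<beta> + \<gamma>)"
  using mult_mem_val_gt[of g \<gamma> f \<beta>] by (simp add: mult.commute add.commute)

text \<open>
  The components in degrees that are not values vanish. The graded ring leaves these degrees out,
  whereas \<open>S\<^sub>v\<close> and \<open>I\<^sub>v\<close> range over all degrees; this is what reconciles the two.
\<close>

lemma val_ge_subset_val_gt: "\<gamma> \<notin> finite_values v \<Longrightarrow> val_ge v \<gamma> \<subseteq> val_gt v \<gamma>"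
proof
  fix f assume "\<gamma> \<notin> finite_values v" and "f \<in> val_ge v \<gamma>"
  then have "v f \<noteq> Fin \<gamma>" "Fin \<gamma> \<le> v f"
    by (metis (mono_tags, lifting) finite_values_def supp_def mem_Collect_eq with_infinity.distinct(1),
        simp add: val_ge_def)
  then show "f \<in> val_gt v \<gamma>"
    by (simp add: val_gt_def)
qed

section \<open>The homogeneous components\<close>

lemma comm_group_val_ge: "comm_group (val_ge_group v \<gamma>)"
proof (rule comm_groupI)
  fix x assume "x \<in> carrier (val_ge_group v \<gamma>)"
  then show "\<exists>y\<in>carrier (val_ge_group v \<gamma>). y \<otimes>\<^bsub>val_ge_group v \<gamma>\<^esub> x = \<one>\<^bsub>val_ge_group v \<gamma>\<^esub>"
    by (intro bexI[of _ "- x"]) (auto simp: val_ge_group_def uminus_mem_val_ge)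
qed (auto simp: val_ge_group_def add_mem_val_ge zero_mem_val_ge ac_simps)

lemma normal_val_gt: "val_gt v \<gamma> \<lhd> val_ge_group v \<gamma>"
proof -
  interpret G: comm_group "val_ge_group v \<gamma>" by (rule comm_group_val_ge)
  have inv: "inv\<^bsub>val_ge_group v \<gamma>\<^esub> x = - x" if "x \<in> val_ge v \<gamma>" for x
    using that
    by (intro G.inv_equality) (auto simp: val_ge_group_def uminus_mem_val_ge)
  have "subgroup (val_gt v \<gamma>) (val_ge_group v \<gamma>)"
  proof (rule G.subgroupI)
    show "val_gt v \<gamma> \<noteq> {}" using zero_mem_val_gt by blast
    show "val_gt v \<gamma> \<subseteq> carrier (val_ge_group v \<gamma>)"
      using val_gt_subset_val_ge by (simp add: val_ge_group_def)
    show "inv\<^bsub>val_ge_group v \<gamma>\<^esub> x \<in> val_gt v \<gamma>" if "x \<in> val_gt v \<gamma>" for x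
      using that inv[OF subsetD[OF val_gt_subset_val_ge that]] by (simp add: uminus_mem_val_gt)
  qed (simp add: val_ge_group_def add_mem_val_gt)
  then show ?thesis
    by (simp add: G.normal_iff_subgroup)
qed

lemma mem_residue_iff: "g \<in> residue v \<gamma> f \<longleftrightarrow> g - f \<in> val_gt v \<gamma>"
  by (auto simp: residue_def r_coset_def val_ge_group_def intro!: bexI[of _ "g - f"])

lemma residue_eq_iff: "residue v \<gamma> f = residue v \<gamma> g \<longleftrightarrow> f - g \<in> val_gt v \<gamma>"
proof
  assume "residue v \<gamma> f = residue v \<gamma> g"
  moreover have "f \<in> residue v \<gamma> f"
    by (simp add: mem_residue_iff zero_mem_val_gt)
  ultimately show "f - g \<in> val_gt v \<gamma>"
    by (simp add: mem_residue_iff)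
next
  assume d: "f - g \<in> val_gt v \<gamma>"
  show "residue v \<gamma> f = residue v \<gamma> g"
  proof (rule Set.set_eqI)
    fix h
    have "h - f = (h - g) - (f - g)" "h - g = (h - f) + (f - g)"
      by simp_all
    then show "h \<in> residue v \<gamma> f \<longleftrightarrow> h \<in> residue v \<gamma> g"
      using add_mem_val_gt[OF _ d, of "h - f"] diff_mem_val_gt[OF _ d, of "h - g"]
      unfolding mem_residue_iff by metis
  qed
qed

lemma component_one: "\<one>\<^bsub>component v \<gamma>\<^esub> = residue v \<gamma> 0"
  by (auto simp: component_def FactGroup_def mem_residue_iff)

lemma component_carrier: "carrier (component v \<gamma>) = residue v \<gamma> ` val_ge v \<gamma>"
  by (auto simp: component_def FactGroup_def RCOSETS_def residue_def val_ge_group_def)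

lemma component_mult:
  assumes "f \<in> val_ge v \<gamma>" and "g \<in> val_ge v \<gamma>"
  shows "residue v \<gamma> f \<otimes>\<^bsub>component v \<gamma>\<^esub> residue v \<gamma> g = residue v \<gamma> (f + g)"
  using normal.rcos_sum[OF normal_val_gt, of f \<gamma> g] assms
  by (simp add: component_def FactGroup_def residue_def val_ge_group_def)

lemma comm_group_component: "comm_group (component v \<gamma>)"
proof -
  interpret G: comm_group "val_ge_group v \<gamma>" by (rule comm_group_val_ge)
  show ?thesis
    unfolding component_def
    using G.abelian_FactGroup normal_imp_subgroup[OF normal_val_gt] by blast
qed

lemma finprod_residue:
  assumes "finite A" and "\<And>i. i \<in> A \<Longrightarrow> h i \<in> val_ge v \<gamma>"
  shows "finprod (component v \<gamma>) (\<lambda>i. residue v \<gamma> (h i)) A = residue v \<gamma> (sum h A)"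
proof -
  interpret comm_group "component v \<gamma>" by (rule comm_group_component)
  show ?thesis
    using assms
  proof (induction A rule: finite_induct)
    case empty
    then show ?case by (simp add: component_one)
  next
    case (insert a A)
    then show ?case
      by (subst finprod_insert) (auto simp: component_carrier component_mult sum_mem_val_ge)
  qed
qed

lemma residue_mult_residue:
  assumes f: "f \<in> val_ge v \<beta>" and g: "g \<in> val_ge v \<gamma>"
  shows "residue_mult v \<beta> \<gamma> (residue v \<beta> f) (residue v \<gamma> g) = residue v (\<beta> + \<gamma>) (f * g)"
proof -
  have "residue v (\<beta> + \<gamma>) (a * b) = residue v (\<beta> + \<gamma>) (f * g)"
    if a: "a \<in> residue v \<beta> f" and b: "b \<in> residue v \<gamma> g" for a b
  proof -
    have "b = g + (b - g)" by simp
    then have "b \<in> val_ge v \<gamma>"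
      using add_mem_val_ge[OF g, of "b - g"] b val_gt_subset_val_ge by (auto simp: mem_residue_iff)
    then have "(a - f) * b \<in> val_gt v (\<beta> + \<gamma>)"
      using a by (intro mult_mem_val_gt) (simp_all add: mem_residue_iff)
    moreover have "f * (b - g) \<in> val_gt v (\<beta> + \<gamma>)"
      using b f by (intro mult_mem_val_gt') (simp_all add: mem_residue_iff)
    ultimately have "(a - f) * b + f * (b - g) \<in> val_gt v (\<beta> + \<gamma>)"
      by (rule add_mem_val_gt)
    then show ?thesis
      by (simp add: residue_eq_iff algebra_simps)
  qed
  moreover have "f \<in> residue v \<beta> f" "g \<in> residue v \<gamma> g"
    by (simp_all add: mem_residue_iff zero_mem_val_gt)
  ultimately show ?thesis
    unfolding residue_mult_def by blast
qed

end

section \<open>The Rees algebra\<close>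

abbreviation lookup :: "('a \<Rightarrow>\<^sub>0 'b) \<Rightarrow> 'a \<Rightarrow> 'b::zero" where
  "lookup \<equiv> Poly_Mapping.lookup"

abbreviation keys :: "('a \<Rightarrow>\<^sub>0 'b::zero) \<Rightarrow> 'a set" where
  "keys \<equiv> Poly_Mapping.keys"

abbreviation single :: "'a \<Rightarrow> 'b \<Rightarrow> ('a \<Rightarrow>\<^sub>0 'b::zero)" where
  "single \<equiv> Poly_Mapping.single"

text \<open>
  The (extended) Rees algebra of the filtration by the groups \<^const>\<open>val_ge\<close>: the function \<open>F\<close> stands
  for \<open>\<Sum> F\<^sub>\<gamma> t\<^sup>\<gamma>\<close>, and multiplication of finitely supported functions is convolution.
\<close>

definition rees_algebra ::
  "('a::comm_ring_1 \<Rightarrow> 'g::linordered_ab_group_add with_infinity) \<Rightarrow> ('g \<Rightarrow>\<^sub>0 'a) set" where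
  "rees_algebra v = {F. \<forall>\<gamma>. lookup F \<gamma> \<in> val_ge v \<gamma>}"

definition rees_ideal ::
  "('a::comm_ring_1 \<Rightarrow> 'g::linordered_ab_group_add with_infinity) \<Rightarrow> ('g \<Rightarrow>\<^sub>0 'a) set" where
  "rees_ideal v = {F. \<forall>\<gamma>. lookup F \<gamma> \<in> val_gt v \<gamma>}"

definition graded_class ::
  "('a::comm_ring_1 \<Rightarrow> 'g::linordered_ab_group_add with_infinity) \<Rightarrow> ('g \<Rightarrow>\<^sub>0 'a) \<Rightarrow> 'g \<Rightarrow> 'a set" where
  "graded_class v F = (\<lambda>\<gamma>\<in>finite_values v. residue v \<gamma> (lookup F \<gamma>))"

lemma rees_algebra_mono: "v \<le> w \<Longrightarrow> rees_algebra v \<subseteq> rees_algebra w"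
  by (auto simp: rees_algebra_def val_ge_def le_fun_def intro: order_trans)

lemma rees_ideal_mono: "v \<le> w \<Longrightarrow> rees_ideal v \<subseteq> rees_ideal w"
  by (auto simp: rees_ideal_def val_gt_def le_fun_def intro: less_le_trans)

lemma lookup_mult_eq_sum:
  fixes F G :: "'g::monoid_add \<Rightarrow>\<^sub>0 'a::semiring_0"
  shows "lookup (F * G) \<delta> =
    (\<Sum>p\<in>{(\<beta>, \<gamma>). \<beta> \<in> keys F \<and> \<gamma> \<in> keys G \<and> \<beta> + \<gamma> = \<delta>}. lookup F (fst p) * lookup G (snd p))"
    (is "_ = sum _ ?P")
proof -
  have fin: "finite ?P"
    by (rule finite_subset[of _ "keys F \<times> keys G"]) auto
  have "lookup (F * G) \<delta> = Sum_any (\<lambda>(a, b). lookup F a * lookup G b when \<delta> = a + b)"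
    using prod_fun_unfold_prod[of "lookup F" "lookup G" \<delta>] by (simp add: lookup_mult prod_fun_def)
  also have "\<dots> = (\<Sum>(a, b)\<in>?P. lookup F a * lookup G b when \<delta> = a + b)"
    using fin by (rule Sum_any.expand_superset) (auto simp: in_keys_iff when_def split: if_splits)
  also have "\<dots> = (\<Sum>p\<in>?P. lookup F (fst p) * lookup G (snd p))"
    by (rule sum.cong) auto
  finally show ?thesis .
qed

context
  fixes v :: "'a::comm_ring_1 \<Rightarrow> 'g::linordered_ab_group_add with_infinity"
  assumes val: "valuation v"
begin

lemma graded_class_eq_iff:
  assumes "F \<in> rees_algebra v" and "G \<in> rees_algebra v"
  shows "graded_class v F = graded_class v G \<longleftrightarrow> F - G \<in> rees_ideal v"
proof -
  have "lookup F \<gamma> - lookup G \<gamma> \<in> val_gt v \<gamma>" if "\<gamma> \<notin> finite_values v" for \<gamma>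
    using that assms val_ge_subset_val_gt[OF val that] by (auto simp: rees_algebra_def intro: diff_mem_val_gt[OF val])
  then show ?thesis
    unfolding graded_class_def rees_ideal_def
    by (auto simp: restrict_def fun_eq_iff residue_eq_iff[OF val] lookup_minus)
qed

lemma degrees_graded_class:
  "degrees v (graded_class v F) = {\<gamma> \<in> finite_values v. lookup F \<gamma> \<notin> val_gt v \<gamma>}"
  by (auto simp: degrees_def graded_class_def component_one[OF val] residue_eq_iff[OF val])

lemma degrees_subset_keys: "degrees v (graded_class v F) \<subseteq> keys F"
  by (auto simp: degrees_graded_class in_keys_iff zero_mem_val_gt[OF val])

lemma carrier_sum_group_component:
  "carrier (sum_group (finite_values v) (component v)) =
     {x \<in> \<Pi>\<^sub>E \<gamma>\<in>finite_values v. carrier (component v \<gamma>). finite (degrees v x)}"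
  by (subst carrier_sum_group)
    (auto simp: degrees_def comm_group.axioms comm_group_component[OF val])

text \<open>
  An element of the direct sum lifts by choosing a representative in each of its finitely many
  non-trivial degrees.
\<close>

lemma carrier_graded_ring: "carrier (graded_ring v) = graded_class v ` rees_algebra v"
proof
  show "graded_class v ` rees_algebra v \<subseteq> carrier (graded_ring v)"
    using finite_subset[OF degrees_subset_keys finite_keys]
    by (auto simp: graded_ring_def carrier_sum_group_component)
      (auto simp: graded_class_def rees_algebra_def component_carrier[OF val])
  show "carrier (graded_ring v) \<subseteq> graded_class v ` rees_algebra v"
  proof
    fix x assume "x \<in> carrier (graded_ring v)"
    then have x: "x \<in> (\<Pi>\<^sub>E \<gamma>\<in>finite_values v. carrier (component v \<gamma>))" and fin: "finite (degrees v x)"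
      by (auto simp: graded_ring_def carrier_sum_group_component)
    have "\<forall>\<gamma>\<in>finite_values v. \<exists>f\<in>val_ge v \<gamma>. x \<gamma> = residue v \<gamma> f"
      using x by (fastforce simp: component_carrier[OF val])
    then obtain r where r: "\<And>\<gamma>. \<gamma> \<in> finite_values v \<Longrightarrow> r \<gamma> \<in> val_ge v \<gamma> \<and> x \<gamma> = residue v \<gamma> (r \<gamma>)"
      by metis
    define F where "F = Abs_poly_mapping (\<lambda>\<gamma>. if \<gamma> \<in> degrees v x then r \<gamma> else 0)"
    have F: "lookup F \<gamma> = (if \<gamma> \<in> degrees v x then r \<gamma> else 0)" for \<gamma>
    proof -
      have "finite {\<gamma>. (if \<gamma> \<in> degrees v x then r \<gamma> else 0) \<noteq> 0}"
        using fin by (rule rev_finite_subset) auto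
      then show ?thesis
        unfolding F_def by simp
    qed
    have "F \<in> rees_algebra v"
      using r by (auto simp: rees_algebra_def F zero_mem_val_ge[OF val] degrees_def)
    moreover have "x = graded_class v F"
    proof
      fix \<gamma>
      show "x \<gamma> = graded_class v F \<gamma>"
      proof (cases "\<gamma> \<in> finite_values v")
        case True
        then show ?thesis
          using r[OF True] by (auto simp: graded_class_def F degrees_def component_one[OF val])
      next
        case False
        then show ?thesis
          using x by (auto simp: graded_class_def PiE_def extensional_def)
      qed
    qed
    ultimately show "x \<in> graded_class v ` rees_algebra v" by blast
  qed
qed

lemma graded_class_single:
  assumes "f \<in> val_ge v \<gamma>"
  shows "single \<gamma> f \<in> rees_algebra v"
    and "graded_class v (single \<gamma> f) =
      (if v f = Fin \<gamma> then initial_form v f else \<zero>\<^bsub>graded_ring v\<^esub>)"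
proof -
  show "single \<gamma> f \<in> rees_algebra v"
    using assms by (auto simp: rees_algebra_def lookup_single when_def zero_mem_val_ge[OF val])
  have "f \<in> val_gt v \<gamma>" if "v f \<noteq> Fin \<gamma>"
    using assms that by (auto simp: val_ge_def val_gt_def)
  then show "graded_class v (single \<gamma> f) =
      (if v f = Fin \<gamma> then initial_form v f else \<zero>\<^bsub>graded_ring v\<^esub>)"
    by (auto simp: fun_eq_iff graded_class_def initial_form_def graded_ring_def lookup_single when_def
        component_one[OF val] residue_eq_iff[OF val] zero_mem_val_gt[OF val])
qed

text \<open>
  The product in the graded ring sums over pairs of degrees of the factors, the convolution over
  pairs of keys, which may be more: the extra pairs have a factor in \<open>P\<^sub>\<gamma>\<^sup>+\<close>, and so contribute zero.
\<close>

lemma graded_class_mult: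
  assumes F: "F \<in> rees_algebra v" and G: "G \<in> rees_algebra v"
  shows "graded_class v F \<otimes>\<^bsub>graded_ring v\<^esub> graded_class v G = graded_class v (F * G)"
proof -
  let ?x = "graded_class v F" and ?y = "graded_class v G"
  have "finprod (component v \<delta>) (\<lambda>(\<beta>, \<gamma>). residue_mult v \<beta> \<gamma> (?x \<beta>) (?y \<gamma>))
      {(\<beta>, \<gamma>). \<beta> \<in> degrees v ?x \<and> \<gamma> \<in> degrees v ?y \<and> \<beta> + \<gamma> = \<delta>}
    = residue v \<delta> (lookup (F * G) \<delta>)" (is "finprod _ _ ?D = _") for \<delta>
  proof -
    let ?P = "{(\<beta>, \<gamma>). \<beta> \<in> keys F \<and> \<gamma> \<in> keys G \<and> \<beta> + \<gamma> = \<delta>}"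
    let ?h = "\<lambda>p. lookup F (fst p) * lookup G (snd p)"
    have finP: "finite ?P"
      by (rule finite_subset[of _ "keys F \<times> keys G"]) auto
    have D: "?D \<subseteq> ?P"
      using degrees_subset_keys by blast
    have mem: "lookup F \<gamma> \<in> val_ge v \<gamma>" "lookup G \<gamma> \<in> val_ge v \<gamma>" for \<gamma>
      using F G by (auto simp: rees_algebra_def)
    have h: "?h p \<in> val_ge v \<delta>" if "p \<in> ?P" for p
      using that mult_mem_val_ge[OF val mem(1)[of "fst p"] mem(2)[of "snd p"]] by auto
    interpret comm_group "component v \<delta>" by (rule comm_group_component[OF val])
    have "finprod (component v \<delta>) (\<lambda>(\<beta>, \<gamma>). residue_mult v \<beta> \<gamma> (?x \<beta>) (?y \<gamma>)) ?D
        = finprod (component v \<delta>) (\<lambda>p. residue v \<delta> (?h p)) ?D"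
    proof (rule finprod_cong')
      show "(\<lambda>p. residue v \<delta> (?h p)) \<in> ?D \<rightarrow> carrier (component v \<delta>)"
        using h subsetD[OF D] unfolding component_carrier[OF val] by blast
      show "(case p of (\<beta>, \<gamma>) \<Rightarrow> residue_mult v \<beta> \<gamma> (?x \<beta>) (?y \<gamma>)) = residue v \<delta> (?h p)"
        if "p \<in> ?D" for p
        using that residue_mult_residue[OF val mem(1)[of "fst p"] mem(2)[of "snd p"]]
        by (auto simp: degrees_def graded_class_def)
    qed simp
    also have "\<dots> = residue v \<delta> (sum ?h ?D)"
      using finite_subset[OF D finP] h[OF subsetD[OF D]] by (rule finprod_residue[OF val])
    also have "\<dots> = residue v \<delta> (sum ?h ?P)"
    proof -
      have "?h p \<in> val_gt v \<delta>" if outside: "p \<in> ?P - ?D" for p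
      proof -
        obtain \<beta> \<gamma> where p: "p = (\<beta>, \<gamma>)" "\<beta> + \<gamma> = \<delta>"
          using DiffD1[OF outside] by auto
        then have "lookup F \<beta> \<in> val_gt v \<beta> \<or> lookup G \<gamma> \<in> val_gt v \<gamma>"
          using outside mem val_ge_subset_val_gt[OF val] by (fastforce simp: degrees_graded_class)
        then show ?thesis
          using p mult_mem_val_gt[OF val, of "lookup F \<beta>" \<beta> "lookup G \<gamma>" \<gamma>]
            mult_mem_val_gt'[OF val, of "lookup F \<beta>" \<beta> "lookup G \<gamma>" \<gamma>] mem by auto
      qed
      then have "sum ?h (?P - ?D) \<in> val_gt v \<delta>"
        by (rule sum_mem_val_gt[OF val])
      then have "sum ?h ?P - sum ?h ?D \<in> val_gt v \<delta>"
        using sum_diff[OF finP D, of ?h] by simp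
      then show ?thesis
        using residue_eq_iff[OF val, of \<delta> "sum ?h ?P" "sum ?h ?D"] by simp
    qed
    finally show ?thesis
      by (simp add: lookup_mult_eq_sum)
  qed
  then show ?thesis
    by (simp add: graded_ring_def graded_class_def[of v "F * G"])
qed

lemma graded_ring_presentation:
  "ring_presentation (rees_algebra v) (graded_class v) (graded_ring v)"
proof
  show "0 \<in> rees_algebra v"
    by (simp add: rees_algebra_def zero_mem_val_ge[OF val])
  have one: "(1 :: 'a) \<in> val_ge v 0"
    by (simp add: val_ge_def valuation_one[OF val])
  show "1 \<in> rees_algebra v"
    using graded_class_single(1)[OF one] by simp
  show "\<one>\<^bsub>graded_ring v\<^esub> = graded_class v 1"
    using graded_class_single(2)[OF one] valuation_one[OF val] by (simp add: graded_ring_def)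
  show "F + G \<in> rees_algebra v" if "F \<in> rees_algebra v" "G \<in> rees_algebra v" for F G
    using that by (simp add: rees_algebra_def lookup_add add_mem_val_ge[OF val])
  show "- F \<in> rees_algebra v" if "F \<in> rees_algebra v" for F
    using that by (simp add: rees_algebra_def uminus_mem_val_ge[OF val])
  show "F * G \<in> rees_algebra v" if "F \<in> rees_algebra v" "G \<in> rees_algebra v" for F G
    unfolding rees_algebra_def mem_Collect_eq lookup_mult_eq_sum
  proof (intro allI sum_mem_val_ge[OF val])
    fix \<delta> p assume "p \<in> {(\<beta>, \<gamma>). \<beta> \<in> keys F \<and> \<gamma> \<in> keys G \<and> \<beta> + \<gamma> = \<delta>}"
    then show "lookup F (fst p) * lookup G (snd p) \<in> val_ge v \<delta>"
      using that mult_mem_val_ge[OF val, of "lookup F (fst p)" "fst p" "lookup G (snd p)" "snd p"]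
      by (auto simp: rees_algebra_def)
  qed
  show "carrier (graded_ring v) = graded_class v ` rees_algebra v"
    by (rule carrier_graded_ring)
  show "\<zero>\<^bsub>graded_ring v\<^esub> = graded_class v 0"
    by (auto simp: graded_ring_def graded_class_def component_one[OF val])
  show "graded_class v F \<oplus>\<^bsub>graded_ring v\<^esub> graded_class v G = graded_class v (F + G)"
    if "F \<in> rees_algebra v" "G \<in> rees_algebra v" for F G
    using that
    by (auto simp: graded_ring_def graded_class_def rees_algebra_def lookup_add component_mult[OF val]
        intro!: restrict_ext)
  show "graded_class v F \<otimes>\<^bsub>graded_ring v\<^esub> graded_class v G = graded_class v (F * G)"
    if "F \<in> rees_algebra v" "G \<in> rees_algebra v" for F G
    using that by (rule graded_class_mult)
qed

end

text \<open>
  The representatives chosen by \<^const>\<open>graded_map\<close> assemble to a lift that differs from \<open>F\<close> by an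
  element of \<open>I\<^sub>v \<subseteq> I\<^sub>w\<close>, and the two cases in its definition are those of \<open>graded_class_single\<close>.
\<close>

lemma graded_map_graded_class:
  fixes v w :: "'a::comm_ring_1 \<Rightarrow> 'g::linordered_ab_group_add with_infinity"
  assumes v: "valuation v" and w: "valuation w" and le: "v \<le> w" and F: "F \<in> rees_algebra v"
  shows "graded_map v w (graded_class v F) = graded_class w F"
proof -
  interpret W: ring_presentation "rees_algebra w" "graded_class w" "graded_ring w"
    by (rule graded_ring_presentation[OF w])
  interpret cring "graded_ring w" by (rule W.presented_cring)
  let ?D = "degrees v (graded_class v F)"
  let ?f = "\<lambda>\<gamma>. SOME f. f \<in> graded_class v F \<gamma>"
  have fin: "finite ?D"
    using finite_subset[OF degrees_subset_keys[OF v] finite_keys] .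
  have F': "lookup F \<gamma> \<in> val_ge v \<gamma>" for \<gamma>
    using F by (simp add: rees_algebra_def)
  have f: "?f \<gamma> - lookup F \<gamma> \<in> val_gt v \<gamma>" "v (?f \<gamma>) = Fin \<gamma>" if "\<gamma> \<in> ?D" for \<gamma>
  proof -
    have \<gamma>: "\<gamma> \<in> finite_values v" "lookup F \<gamma> \<notin> val_gt v \<gamma>"
      using that by (auto simp: degrees_graded_class[OF v])
    then have "lookup F \<gamma> \<in> graded_class v F \<gamma>"
      by (simp add: graded_class_def mem_residue_iff[OF v] zero_mem_val_gt[OF v])
    then have "?f \<gamma> \<in> graded_class v F \<gamma>"
      by (rule someI)
    then show d: "?f \<gamma> - lookup F \<gamma> \<in> val_gt v \<gamma>"
      using \<gamma> by (simp add: graded_class_def mem_residue_iff[OF v])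
    have "?f \<gamma> \<notin> val_gt v \<gamma>"
      using diff_mem_val_gt[OF v _ d, of "?f \<gamma>"] \<gamma> by auto
    moreover have "?f \<gamma> \<in> val_ge v \<gamma>"
      using add_mem_val_ge[OF v F', of "?f \<gamma> - lookup F \<gamma>" \<gamma>] d val_gt_subset_val_ge[OF v, of \<gamma>] by auto
    ultimately show "v (?f \<gamma>) = Fin \<gamma>"
      by (auto simp: val_ge_def val_gt_def)
  qed
  have ge: "f \<in> val_ge w \<gamma>" if "f \<in> val_ge v \<gamma>" for f \<gamma>
    using that le by (auto simp: val_ge_def le_fun_def intro: order_trans)
  have gt: "f \<in> val_gt w \<gamma>" if "f \<in> val_gt v \<gamma>" for f \<gamma>
    using that le by (auto simp: val_gt_def le_fun_def intro: less_le_trans)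
  have F\<^sub>w: "F \<in> rees_algebra w"
    using F rees_algebra_mono[OF le] by blast
  have f_ge: "?f \<gamma> \<in> val_ge w \<gamma>" if "\<gamma> \<in> ?D" for \<gamma>
    using f(2)[OF that] by (intro ge) (simp add: val_ge_def)
  have "graded_map v w (graded_class v F) = (\<Oplus>\<^bsub>graded_ring w\<^esub>\<gamma>\<in>?D. graded_class w (single \<gamma> (?f \<gamma>)))"
    unfolding graded_map_def
    using f_ge f(2) graded_class_single[OF w] W.carrier_eq
    by (intro finsum_cong') (auto simp: Let_def eq_commute)
  also have "\<dots> = graded_class w (\<Sum>\<gamma>\<in>?D. single \<gamma> (?f \<gamma>))"
    using fin f_ge by (intro W.hom_finsum) (auto intro: graded_class_single(1)[OF w])
  also have "\<dots> = graded_class w F"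
  proof (subst graded_class_eq_iff[OF w _ F\<^sub>w])
    show "(\<Sum>\<gamma>\<in>?D. single \<gamma> (?f \<gamma>)) \<in> rees_algebra w"
      using f_ge by (intro W.sum_mem graded_class_single(1)[OF w])
    have "lookup (\<Sum>\<gamma>\<in>?D. single \<gamma> (?f \<gamma>)) \<delta> = (if \<delta> \<in> ?D then ?f \<delta> else 0)" for \<delta>
      using fin by (simp add: lookup_sum lookup_single when_def)
    moreover have "lookup F \<delta> \<in> val_gt v \<delta>" if "\<delta> \<notin> ?D" for \<delta>
      using that F' val_ge_subset_val_gt[OF v] by (auto simp: degrees_graded_class[OF v])
    ultimately show "(\<Sum>\<gamma>\<in>?D. single \<gamma> (?f \<gamma>)) - F \<in> rees_ideal w"
      using f(1) by (auto simp: rees_ideal_def lookup_minus uminus_mem_val_gt[OF v] intro!: gt)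
  qed
  finally show ?thesis .
qed

section \<open>Stability\<close>

lemma add_less_with_infinity:
  fixes a b a' b' :: "'g::linordered_ab_group_add with_infinity"
  assumes "a \<le> a'" and "b < b'"
  shows "a + b < a' + b' \<or> a + b = \<infinity> \<and> a' + b' = \<infinity>"
  using assms
  by (cases a; cases a'; cases b; cases b')
    (auto intro: add_le_less_mono add_mono)

text \<open>
  Let \<open>Q\<close> have least degree among the polynomials whose value increases from \<open>v\<close> to \<open>u\<close>. If the value
  of \<open>g\<close> increases, write \<open>g = q Q + r\<close> with \<open>degree r < degree Q\<close>. The value of \<open>r\<close> does not increase,
  and this forces \<open>v r > v g\<close>: the initial form of \<open>g\<close> in the graded ring of \<open>v\<close> is a multiple
  of that of \<open>Q\<close>. Since \<open>w \<noteq> v\<close>, some value increases from \<open>v\<close> to \<open>w\<close>; taking such a polynomial of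
  least degree shows that the value of \<open>Q\<close> does. Hence every value that increases from \<open>v\<close> to \<open>u\<close>
  increases from \<open>v\<close> to \<open>w\<close>.
\<close>

lemma valuation_eq_upper_bound:
  fixes v w u :: "'k::field poly \<Rightarrow> 'g::linordered_ab_group_add with_infinity"
  assumes v: "valuation v" and w: "valuation w" and u: "valuation u"
    and const: "\<And>c. v [:c:] = u [:c:]"
    and "v \<le> w" "v \<noteq> w" "w \<le> u" and eq: "v f = w f"
  shows "v f = u f"
proof (rule ccontr)
  have vw: "v g \<le> w g" and wu: "w g \<le> u g" for g
    using \<open>v \<le> w\<close> \<open>w \<le> u\<close> by (auto simp: le_fun_def)
  then have vu: "v g \<le> u g" for g
    using order_trans by blast
  assume "v f \<noteq> u f"
  then have f: "v f < u f"
    using vu[of f] by simp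
  obtain Q where Q: "v Q < u Q" and minQ: "\<And>g. v g < u g \<Longrightarrow> degree Q \<le> degree g"
    using exists_least_iff[of "\<lambda>n. \<exists>g. v g < u g \<and> degree g = n"] f by (metis not_le)
  obtain h where h: "v h < w h" and minh: "\<And>g. v g < w g \<Longrightarrow> degree h \<le> degree g"
  proof -
    obtain g where "v g < w g"
      using \<open>v \<noteq> w\<close> vw by (metis ext order.order_iff_strict)
    then show ?thesis
      using that exists_least_iff[of "\<lambda>n. \<exists>g. v g < w g \<and> degree g = n"] by (metis not_le)
  qed
  have "degree Q \<noteq> 0"
    using Q const by (metis degree_eq_zeroE less_irrefl)
  \<comment> \<open>The initial form of \<open>g\<close> is a multiple of that of \<open>Q\<close>. Otherwise \<open>r\<close> would have \<open>u r = v r \<le> v g < u g\<close>,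
    so that \<open>u (q Q) = u r\<close> would not exceed \<open>v (q Q)\<close>, although \<open>u Q > v Q\<close>.\<close>
  have initial: "v g < v (g - g div Q * Q)" if g: "v g < u g" for g
  proof (rule ccontr)
    let ?q = "g div Q" and ?r = "g mod Q"
    have r: "g - ?q * Q = ?r"
      by (simp add: minus_div_mult_eq_mod)
    assume "\<not> ?thesis"
    then have le: "v ?r \<le> v g"
      using r by simp
    have "degree ?r < degree Q"
      using degree_mod_less'[of Q g] \<open>degree Q \<noteq> 0\<close> by (metis degree_0 gr0I)
    then have ur: "u ?r = v ?r"
      using minQ[of ?r] vu[of ?r] by fastforce
    have "v ?r < u g"
      using le g by simp
    moreover have "u ?r \<ge> min (u g) (u (?q * Q))"
      using valuation_diff[OF u, of g "?q * Q"] r by simp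
    ultimately have "u (?q * Q) \<le> v ?r"
      using ur by (auto simp: min_def split: if_splits)
    moreover have "v (?q * Q) \<ge> v ?r"
      using valuation_diff[OF v, of g ?r] le unfolding minus_mod_eq_div_mult by simp
    ultimately have "u (?q * Q) = \<infinity>"
      using add_less_with_infinity[OF vu[of ?q] Q]
      unfolding valuation_mult[OF v] valuation_mult[OF u] by auto
    then have "v ?r = \<infinity>"
      using \<open>u (?q * Q) \<le> v ?r\<close> by (cases "v ?r") auto
    then show False
      using \<open>v ?r < u g\<close> by (cases "u g") auto
  qed
  \<comment> \<open>Otherwise \<open>v\<close> and \<open>w\<close> would agree on \<open>Q\<close> and, by minimality of \<open>h\<close>, on the quotient of \<open>h\<close> by \<open>Q\<close>,
    hence on the term that carries the initial form of \<open>h\<close>.\<close>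
  have "v Q < w Q"
  proof (rule ccontr)
    assume "\<not> ?thesis"
    then have wQ: "w Q = v Q"
      using vw[of Q] by simp
    let ?q = "h div Q"
    have hu: "v h < u h"
      using h wu[of h] by simp
    have "degree ?q < degree h"
      using minQ[OF hu] \<open>degree Q \<noteq> 0\<close> by (simp add: degree_div_less)
    then have "w ?q = v ?q"
      using minh[of ?q] vw[of ?q] by fastforce
    then have "w (?q * Q) = v (?q * Q)"
      using wQ by (simp add: valuation_mult[OF v] valuation_mult[OF w])
    moreover have "w (?q * Q) > v h"
      using valuation_diff[OF w, of h "h - ?q * Q"] h initial[OF hu] vw[of "h - ?q * Q"]
      by (auto simp: min_def split: if_splits)
    moreover have "v h \<ge> min (v (h - ?q * Q)) (v (?q * Q))"
      using valuation_add[OF v, of "h - ?q * Q" "?q * Q"] by simp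
    ultimately show False
      using initial[OF hu] by (auto simp: min_def split: if_splits)
  qed
  let ?q = "f div Q"
  have "w (?q * Q) > v f"
  proof -
    have "v (?q * Q) \<ge> v f"
      using valuation_diff[OF v, of f "f - ?q * Q"] initial[OF f] by (auto simp: min_def split: if_splits)
    moreover have "v (?q * Q) < w (?q * Q) \<or> w (?q * Q) = \<infinity>"
      using add_less_with_infinity[OF vw[of ?q] \<open>v Q < w Q\<close>]
      unfolding valuation_mult[OF v] valuation_mult[OF w] by auto
    moreover have "v f < \<infinity>"
      using f by (cases "v f"; cases "u f") auto
    ultimately show ?thesis by auto
  qed
  then have "w f > v f"
    using valuation_add[OF w, of "f - ?q * Q" "?q * Q"] initial[OF f] vw[of "f - ?q * Q"]
    by (auto simp: min_def split: if_splits)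
  then show False
    using eq by simp
qed


text \<open>
  If the value of \<open>f\<close> is constant from \<open>v\<close> on and \<open>v\<close> is not the largest member of \<open>V\<close>, then \<open>f\<close> has
  the same value at \<open>v\<close> and at some larger \<open>w\<close> below \<open>\<nu>\<close>. If \<open>v\<close> is the largest member, it is \<open>\<nu>\<close>.
\<close>

lemma stable_value_eq:
  fixes \<nu>\<^sub>0 :: "'k::field \<Rightarrow> 'g::linordered_ab_group_add with_infinity"
  assumes V: "V \<subseteq> extensions \<nu>\<^sub>0" and total: "\<forall>\<mu>\<in>V. \<forall>\<rho>\<in>V. \<mu> \<le> \<rho> \<or> \<rho> \<le> \<mu>"
    and \<nu>: "\<nu> \<in> extensions \<nu>\<^sub>0" and upper: "\<forall>\<mu>\<in>V. \<mu> \<le> \<nu>"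
    and greatest: "\<forall>\<mu>\<in>V. (\<forall>\<rho>\<in>V. \<rho> \<le> \<mu>) \<longrightarrow> \<mu> = \<nu>"
    and "stable V f"
  shows "\<exists>v\<in>V. v f = \<nu> f"
proof -
  obtain v where v: "v \<in> V" and st: "\<And>w. w \<in> V \<Longrightarrow> v \<le> w \<Longrightarrow> w f = v f"
    using \<open>stable V f\<close> by (auto simp: stable_def)
  show ?thesis
  proof (cases "\<forall>w\<in>V. w \<le> v")
    case True
    then show ?thesis using greatest v by auto
  next
    case False
    then obtain w where w: "w \<in> V" "v \<le> w" "v \<noteq> w"
      using total v by auto
    have "v f = \<nu> f"
    proof (rule valuation_eq_upper_bound[of v w \<nu>])
      show "v [:c:] = \<nu> [:c:]" for c
        using v \<nu> V by (auto simp: extensions_def)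
    qed (use v w V \<nu> upper st[OF w(1,2)] in \<open>auto simp: extensions_def\<close>)
    then show ?thesis using v by blast
  qed
qed

section \<open>The direct limit\<close>

text \<open>
  The comparison of the limit with the graded ring of the upper bound holds for every commutative
  ring in which stable elements attain their value at the bound.
\<close>

locale valuation_chain =
  fixes V :: "('a::comm_ring_1 \<Rightarrow> 'g::linordered_ab_group_add with_infinity) set"
    and \<nu> :: "'a \<Rightarrow> 'g with_infinity"
  assumes nonempty: "V \<noteq> {}"
    and val_V: "v \<in> V \<Longrightarrow> valuation v"
    and val_\<nu>: "valuation \<nu>"
    and total: "v \<in> V \<Longrightarrow> w \<in> V \<Longrightarrow> v \<le> w \<or> w \<le> v"
    and upper: "v \<in> V \<Longrightarrow> v \<le> \<nu>"
    and stable_value: "stable V f \<Longrightarrow> \<exists>v\<in>V. v f = \<nu> f"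
begin

definition stable_rees_algebra :: "('g \<Rightarrow>\<^sub>0 'a) set" where
  "stable_rees_algebra = (\<Union>v\<in>V. rees_algebra v)"

text \<open>
  An element of the direct limit is a set of pairs of a member \<open>v\<close> of \<open>V\<close> and an element of its graded
  ring. This is the one represented by \<open>F\<close> in \<open>T\<close>, described by congruence modulo \<open>I\<^sub>\<nu>\<close> instead of
  equality at a later stage of the system.
\<close>

definition limit_class :: "('g \<Rightarrow>\<^sub>0 'a) \<Rightarrow> (('a \<Rightarrow> 'g with_infinity) \<times> ('g \<Rightarrow> 'a set)) set" where
  "limit_class F = {(v, graded_class v G) | v G. v \<in> V \<and> G \<in> rees_algebra v \<and> G - F \<in> rees_ideal \<nu>}"

lemma common_upper: "v \<in> V \<Longrightarrow> w \<in> V \<Longrightarrow> \<exists>k\<in>V. v \<le> k \<and> w \<le> k"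
  using total by blast

lemma stable_iff: "stable V f \<longleftrightarrow> (\<exists>v\<in>V. v f = \<nu> f)"
proof
  assume "\<exists>v\<in>V. v f = \<nu> f"
  then obtain v where v: "v \<in> V" "v f = \<nu> f" by blast
  have "w f = v f" if "w \<in> V" "v \<le> w" for w
    using that upper[of w] v by (metis antisym le_funD)
  then show "stable V f"
    using v unfolding stable_def by blast
qed (rule stable_value)

lemma subset_\<nu>: "stable_rees_algebra \<subseteq> rees_algebra \<nu>"
  using rees_algebra_mono upper by (auto simp: stable_rees_algebra_def)

lemma mem_common:
  assumes "F \<in> stable_rees_algebra" and "G \<in> stable_rees_algebra"
  obtains v where "v \<in> V" "F \<in> rees_algebra v" "G \<in> rees_algebra v"
proof -
  obtain v w where "v \<in> V" "w \<in> V" "F \<in> rees_algebra v" "G \<in> rees_algebra w"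
    using assms by (auto simp: stable_rees_algebra_def)
  moreover from this obtain k where "k \<in> V" "v \<le> k" "w \<le> k"
    using common_upper by blast
  ultimately show ?thesis
    using that rees_algebra_mono by blast
qed

text \<open>
  If every member of \<open>V\<close> above \<open>v\<close> gave \<open>f\<close> the value \<open>\<gamma>\<close>, then \<open>f\<close> would be stable and \<open>\<nu> f = \<gamma>\<close>.
\<close>

lemma exceeds_before_limit:
  assumes v: "v \<in> V" and f: "f \<in> val_ge v \<gamma>" "f \<in> val_gt \<nu> \<gamma>"
  shows "\<exists>k\<in>V. v \<le> k \<and> f \<in> val_gt k \<gamma>"
proof (rule ccontr)
  assume none: "\<not> ?thesis"
  have *: "k f = Fin \<gamma>" if "k \<in> V" "v \<le> k" for k
  proof -
    have "f \<in> val_ge k \<gamma>" "f \<notin> val_gt k \<gamma>"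
      using that none f by (auto simp: val_ge_def le_fun_def intro: order_trans)
    then show ?thesis by (auto simp: val_ge_def val_gt_def)
  qed
  then have "stable V f"
    using v unfolding stable_def by (metis order_refl)
  then obtain w where w: "w \<in> V" "w f = \<nu> f"
    using stable_value by blast
  obtain k where k: "k \<in> V" "v \<le> k" "w \<le> k"
    using common_upper v w by blast
  have "\<nu> f \<le> k f"
    using w k by (metis le_funD)
  then show False
    using * k f by (auto simp: val_gt_def)
qed

text \<open>
  Injectivity of the comparison: what vanishes in the graded ring of \<open>\<nu>\<close> vanishes at a stage of the
  system. Finitely many coefficients have to be treated, and \<open>V\<close> is a chain.
\<close>

lemma rees_ideal_before_limit:
  assumes v: "v \<in> V" and F: "F \<in> rees_algebra v" "F \<in> rees_ideal \<nu>"
  shows "\<exists>k\<in>V. v \<le> k \<and> F \<in> rees_ideal k"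
proof -
  have "\<exists>k\<in>V. v \<le> k \<and> (\<forall>\<gamma>\<in>A. lookup F \<gamma> \<in> val_gt k \<gamma>)" if "finite A" for A
    using that
  proof (induction A rule: finite_induct)
    case empty
    then show ?case using v by auto
  next
    case (insert \<gamma> A)
    obtain k where k: "k \<in> V" "v \<le> k" "\<forall>\<delta>\<in>A. lookup F \<delta> \<in> val_gt k \<delta>"
      using insert.IH by blast
    obtain l where l: "l \<in> V" "v \<le> l" "lookup F \<gamma> \<in> val_gt l \<gamma>"
      using exceeds_before_limit[OF v, of "lookup F \<gamma>" \<gamma>] F
      by (auto simp: rees_algebra_def rees_ideal_def)
    obtain m where m: "m \<in> V" "k \<le> m" "l \<le> m"
      using common_upper k l by blast
    have "lookup F \<delta> \<in> val_gt m \<delta>" if "\<delta> \<in> insert \<gamma> A" for \<delta>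
      using that k l m by (auto simp: val_gt_def le_fun_def intro: less_le_trans)
    then show ?case
      using m k order_trans by blast
  qed
  then obtain k where k: "k \<in> V" "v \<le> k" "\<forall>\<gamma>\<in>keys F. lookup F \<gamma> \<in> val_gt k \<gamma>"
    by (metis finite_keys)
  have "lookup F \<gamma> \<in> val_gt k \<gamma>" for \<gamma>
    using k zero_mem_val_gt[OF val_V[OF k(1)], of \<gamma>] by (cases "\<gamma> \<in> keys F") (auto simp: in_keys_iff)
  then have "F \<in> rees_ideal k"
    by (simp add: rees_ideal_def)
  then show ?thesis using k by blast
qed

lemma presentation: "v \<in> V \<Longrightarrow> ring_presentation (rees_algebra v) (graded_class v) (graded_ring v)"
  by (rule graded_ring_presentation[OF val_V])

lemma ring_closed:
  shows "0 \<in> stable_rees_algebra" and "1 \<in> stable_rees_algebra"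
    and "F \<in> stable_rees_algebra \<Longrightarrow> - F \<in> stable_rees_algebra"
    and "F \<in> stable_rees_algebra \<Longrightarrow> G \<in> stable_rees_algebra \<Longrightarrow> F + G \<in> stable_rees_algebra"
    and "F \<in> stable_rees_algebra \<Longrightarrow> G \<in> stable_rees_algebra \<Longrightarrow> F * G \<in> stable_rees_algebra"
proof -
  obtain v where v: "v \<in> V" using nonempty by blast
  interpret ring_presentation "rees_algebra v" "graded_class v" "graded_ring v"
    by (rule presentation[OF v])
  show "0 \<in> stable_rees_algebra" "1 \<in> stable_rees_algebra"
    using v zero_mem one_mem by (auto simp: stable_rees_algebra_def)
next
  assume "F \<in> stable_rees_algebra"
  then show "- F \<in> stable_rees_algebra"
    using ring_presentation.uminus_mem[OF presentation] by (auto simp: stable_rees_algebra_def)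
next
  assume "F \<in> stable_rees_algebra" "G \<in> stable_rees_algebra"
  then obtain v where v: "v \<in> V" "F \<in> rees_algebra v" "G \<in> rees_algebra v"
    by (rule mem_common)
  then have "F + G \<in> rees_algebra v" "F * G \<in> rees_algebra v"
    using ring_presentation.add_mem[OF presentation] ring_presentation.mult_mem[OF presentation]
    by auto
  then show "F + G \<in> stable_rees_algebra" "F * G \<in> stable_rees_algebra"
    using v unfolding stable_rees_algebra_def by blast+
qed

sublocale top: ring_presentation "rees_algebra \<nu>" "graded_class \<nu>" "graded_ring \<nu>"
  by (rule graded_ring_presentation[OF val_\<nu>])

lemma subring_image: "subring (graded_class \<nu> ` stable_rees_algebra) (graded_ring \<nu>)"
proof -
  interpret cring "graded_ring \<nu>" by (rule top.presented_cring)
  let ?H = "graded_class \<nu> ` stable_rees_algebra"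
  show ?thesis
  proof (rule subringI)
    show sub: "?H \<subseteq> carrier (graded_ring \<nu>)"
      using subset_\<nu> top.carrier_eq by blast
    show "\<ominus>\<^bsub>graded_ring \<nu>\<^esub> h \<in> ?H" if "h \<in> ?H" for h
    proof -
      obtain F where F: "F \<in> stable_rees_algebra" "h = graded_class \<nu> F"
        using \<open>h \<in> ?H\<close> by blast
      have "graded_class \<nu> (- F) \<oplus>\<^bsub>graded_ring \<nu>\<^esub> h = \<zero>\<^bsub>graded_ring \<nu>\<^esub>"
        using F ring_closed subset_\<nu> by (subst F(2), subst top.hom_add) (auto simp: top.hom_zero)
      then have "\<ominus>\<^bsub>graded_ring \<nu>\<^esub> h = graded_class \<nu> (- F)"
        using F ring_closed(3)[OF F(1)] sub by (intro minus_equality) auto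
      then show ?thesis using ring_closed(3)[OF F(1)] by blast
    qed
  qed (use subset_\<nu> ring_closed top.hom_one top.hom_add top.hom_mult in \<open>auto simp: subset_iff\<close>)
qed

text \<open>
  A stable \<open>f\<close> with \<open>v f = \<nu> f = \<gamma>\<close> gives the monomial \<open>f t\<^sup>\<gamma>\<close> of \<open>S\<^sub>v\<close>. Conversely a monomial \<open>f t\<^sup>\<gamma>\<close> of
  \<open>S\<^sub>v\<close> has \<open>\<gamma> \<le> v f \<le> \<nu> f\<close>: either \<open>\<nu> f > \<gamma>\<close> and its class is zero, or \<open>v f = \<nu> f\<close> and \<open>f\<close> is stable.
\<close>

lemma stable_subring_eq: "stable_subring V \<nu> = graded_class \<nu> ` stable_rees_algebra"
proof
  interpret cring "graded_ring \<nu>" by (rule top.presented_cring)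
  let ?M = "add_monoid (graded_ring \<nu>)"
  let ?B = "{initial_form \<nu> f | f. stable V f}"
  have gen: "?B \<subseteq> graded_class \<nu> ` stable_rees_algebra"
  proof clarify
    fix f assume "stable V f"
    then obtain v where v: "v \<in> V" "v f = \<nu> f"
      using stable_value by blast
    show "initial_form \<nu> f \<in> graded_class \<nu> ` stable_rees_algebra"
    proof (cases "\<nu> f")
      case Infinity
      then have "initial_form \<nu> f = graded_class \<nu> 0"
        by (simp add: initial_form_def graded_class_def component_one[OF val_\<nu>])
      then show ?thesis using ring_closed by blast
    next
      case (Fin \<gamma>)
      then have "single \<gamma> f \<in> rees_algebra v" "graded_class \<nu> (single \<gamma> f) = initial_form \<nu> f"
        using graded_class_single[OF val_V, of v f \<gamma>] graded_class_single[OF val_\<nu>, of f \<gamma>] v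
        by (auto simp: val_ge_def)
      then show ?thesis using v by (force simp: stable_rees_algebra_def)
    qed
  qed
  show "stable_subring V \<nu> \<subseteq> graded_class \<nu> ` stable_rees_algebra"
    unfolding stable_subring_def
    by (rule add.generate_subgroup_incl[OF gen subring.axioms(1)[OF subring_image]])
  show "graded_class \<nu> ` stable_rees_algebra \<subseteq> stable_subring V \<nu>"
  proof clarify
    fix F assume "F \<in> stable_rees_algebra"
    then obtain v where v: "v \<in> V" "F \<in> rees_algebra v"
      by (auto simp: stable_rees_algebra_def)
    have F: "lookup F \<gamma> \<in> val_ge v \<gamma>" "lookup F \<gamma> \<in> val_ge \<nu> \<gamma>" for \<gamma>
      using v rees_algebra_mono[OF upper[OF v(1)]] by (auto simp: rees_algebra_def)
    have mem: "graded_class \<nu> (single \<gamma> (lookup F \<gamma>)) \<in> stable_subring V \<nu>" for \<gamma>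
    proof (cases "\<nu> (lookup F \<gamma>) = Fin \<gamma>")
      case True
      then have "v (lookup F \<gamma>) \<le> Fin \<gamma>"
        using le_funD[OF upper[OF v(1)], of "lookup F \<gamma>"] by simp
      then have "v (lookup F \<gamma>) = Fin \<gamma>"
        using F(1)[of \<gamma>] by (simp add: val_ge_def)
      then have "stable V (lookup F \<gamma>)"
        using True v stable_iff by auto
      then show ?thesis
        using True graded_class_single(2)[OF val_\<nu> F(2)]
        by (auto simp: stable_subring_def intro!: generate.incl)
    next
      case False
      then show ?thesis
        using graded_class_single(2)[OF val_\<nu> F(2)] generate.one[of ?M ?B]
        by (simp add: stable_subring_def)
    qed
    have "graded_class \<nu> (\<Sum>\<gamma>\<in>A. single \<gamma> (lookup F \<gamma>)) \<in> stable_subring V \<nu>" if "finite A" for A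
      using that
    proof (induction A rule: finite_induct)
      case empty
      then show ?case
        using generate.one[of ?M ?B] by (simp add: stable_subring_def top.hom_zero)
    next
      case (insert \<gamma> A)
      have "graded_class \<nu> (\<Sum>\<delta>\<in>insert \<gamma> A. single \<delta> (lookup F \<delta>)) =
          graded_class \<nu> (single \<gamma> (lookup F \<gamma>))
          \<oplus>\<^bsub>graded_ring \<nu>\<^esub> graded_class \<nu> (\<Sum>\<delta>\<in>A. single \<delta> (lookup F \<delta>))"
        using insert.hyps F
        by (simp add: top.hom_add top.sum_mem graded_class_single(1)[OF val_\<nu>])
      moreover have "\<dots> \<in> stable_subring V \<nu>"
        using generate.eng[OF mem[of \<gamma>, unfolded stable_subring_def] insert.IH[unfolded stable_subring_def]]
        by (simp add: stable_subring_def)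
      ultimately show ?case
        by simp
    qed
    then have "graded_class \<nu> (\<Sum>\<gamma>\<in>keys F. single \<gamma> (lookup F \<gamma>)) \<in> stable_subring V \<nu>"
      by simp
    moreover have "(\<Sum>\<gamma>\<in>keys F. single \<gamma> (lookup F \<gamma>)) = F"
      by (rule poly_mapping_eqI) (simp add: lookup_sum lookup_single when_def in_keys_iff)
    ultimately show "graded_class \<nu> F \<in> stable_subring V \<nu>"
      by simp
  qed
qed

lemma stable_subring_presentation:
  "ring_presentation stable_rees_algebra (graded_class \<nu>) (graded_ring \<nu>\<lparr>carrier := stable_subring V \<nu>\<rparr>)"
  by unfold_locales
    (simp_all add: ring_closed stable_subring_eq top.hom_zero top.hom_one top.hom_add top.hom_mult
      subsetD[OF subset_\<nu>])

lemma ideal_diff_trans: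
  "F - G \<in> rees_ideal \<nu> \<Longrightarrow> G - H \<in> rees_ideal \<nu> \<Longrightarrow> F - H \<in> rees_ideal \<nu>"
  using add_mem_val_gt[OF val_\<nu>, of "lookup F \<gamma> - lookup G \<gamma>" \<gamma> "lookup G \<gamma> - lookup H \<gamma>" for \<gamma>]
  by (auto simp: rees_ideal_def lookup_minus)

lemma ideal_diff_commute: "F - G \<in> rees_ideal \<nu> \<longleftrightarrow> G - F \<in> rees_ideal \<nu>"
  using uminus_mem_val_gt[OF val_\<nu>, of "lookup F \<gamma> - lookup G \<gamma>" \<gamma> for \<gamma>]
    uminus_mem_val_gt[OF val_\<nu>, of "lookup G \<gamma> - lookup F \<gamma>" \<gamma> for \<gamma>]
  by (auto simp: rees_ideal_def lookup_minus)

lemma limit_class_eq_iff: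
  assumes "F \<in> stable_rees_algebra" and "G \<in> stable_rees_algebra"
  shows "limit_class F = limit_class G \<longleftrightarrow> graded_class \<nu> F = graded_class \<nu> G"
proof -
  have "limit_class F = limit_class G \<longleftrightarrow> F - G \<in> rees_ideal \<nu>"
  proof
    assume eq: "limit_class F = limit_class G"
    obtain v where v: "v \<in> V" "F \<in> rees_algebra v"
      using assms by (auto simp: stable_rees_algebra_def)
    have "0 \<in> rees_ideal \<nu>"
      by (simp add: rees_ideal_def zero_mem_val_gt[OF val_\<nu>])
    then have "(v, graded_class v F) \<in> limit_class F"
      using v unfolding limit_class_def by force
    then have "(v, graded_class v F) \<in> limit_class G"
      using eq by simp
    then obtain H where H: "H \<in> rees_algebra v" "graded_class v F = graded_class v H"
      "H - G \<in> rees_ideal \<nu>"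
      by (auto simp: limit_class_def)
    then have "F - H \<in> rees_ideal \<nu>"
      using graded_class_eq_iff[OF val_V] v rees_ideal_mono[OF upper] by blast
    then show "F - G \<in> rees_ideal \<nu>"
      using H ideal_diff_trans by blast
  next
    assume "F - G \<in> rees_ideal \<nu>"
    then have "H - F \<in> rees_ideal \<nu> \<longleftrightarrow> H - G \<in> rees_ideal \<nu>" for H
      using ideal_diff_trans ideal_diff_commute by blast
    then show "limit_class F = limit_class G"
      by (simp add: limit_class_def)
  qed
  then show ?thesis
    using assms subset_\<nu> graded_class_eq_iff[OF val_\<nu>] by blast
qed

lemma graded_map_class:
  "v \<in> V \<Longrightarrow> w \<in> V \<Longrightarrow> v \<le> w \<Longrightarrow> F \<in> rees_algebra v \<Longrightarrow>
    graded_map v w (graded_class v F) = graded_class w F"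
  by (rule graded_map_graded_class[OF val_V val_V])

text \<open>
  Two elements that become equal at a stage of the system are congruent modulo \<open>I\<^sub>\<nu>\<close>, and the
  converse is \<open>rees_ideal_before_limit\<close>, applied to their difference.
\<close>

lemma direct_limit_class_eq:
  assumes v: "v \<in> V" and F: "F \<in> rees_algebra v"
  shows "direct_limit_class V graded_ring graded_map v (graded_class v F) = limit_class F"
proof -
  have car: "carrier (graded_ring w) = graded_class w ` rees_algebra w" if "w \<in> V" for w
    using ring_presentation.carrier_eq[OF presentation[OF that]] .
  have merge: "(\<exists>k\<in>V. v \<le> k \<and> w \<le> k \<and>
        graded_map v k (graded_class v F) = graded_map w k (graded_class w G))
      \<longleftrightarrow> G - F \<in> rees_ideal \<nu>" (is "?L \<longleftrightarrow> ?R")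
    if w: "w \<in> V" and G: "G \<in> rees_algebra w" for w G
  proof
    assume ?L
    then obtain k where k: "k \<in> V" "v \<le> k" "w \<le> k" "graded_class k F = graded_class k G"
      using v w F G by (auto simp: graded_map_class)
    then have "F - G \<in> rees_ideal k"
      using F G rees_algebra_mono graded_class_eq_iff[OF val_V] by blast
    then show ?R
      using rees_ideal_mono[OF upper] k ideal_diff_commute by blast
  next
    assume ?R
    then have FG: "F - G \<in> rees_ideal \<nu>"
      by (simp add: ideal_diff_commute)
    obtain l where l: "l \<in> V" "v \<le> l" "w \<le> l"
      using common_upper v w by blast
    interpret l: ring_presentation "rees_algebra l" "graded_class l" "graded_ring l"
      by (rule presentation[OF l(1)])
    have "F \<in> rees_algebra l" "G \<in> rees_algebra l"
      using l F G rees_algebra_mono by blast+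
    then have "F - G \<in> rees_algebra l"
      using l.add_mem[of F "- G"] l.uminus_mem by simp
    then obtain k where k: "k \<in> V" "l \<le> k" "F - G \<in> rees_ideal k"
      using rees_ideal_before_limit[OF l(1) _ FG] by blast
    then have le: "v \<le> k" "w \<le> k"
      using l order_trans by blast+
    then have "graded_class k F = graded_class k G"
      using k F G rees_algebra_mono graded_class_eq_iff[OF val_V[OF k(1)]] by blast
    then show ?L
      using k le v w F G graded_map_class by metis
  qed
  have "direct_limit_class V graded_ring graded_map v (graded_class v F) =
      {(w, graded_class w G) | w G. w \<in> V \<and> G \<in> rees_algebra w \<and>
        (\<exists>k\<in>V. v \<le> k \<and> w \<le> k \<and> graded_map v k (graded_class v F) = graded_map w k (graded_class w G))}"
    using v F by (auto simp: direct_limit_class_def direct_limit_rel_def car) blast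
  also have "\<dots> = limit_class F"
    unfolding limit_class_def by (simp add: merge cong: conj_cong)
  finally show ?thesis .
qed

lemma limit_class_nonempty:
  assumes "F \<in> stable_rees_algebra"
  shows "\<exists>v G. (v, graded_class v G) \<in> limit_class F \<and> v \<in> V \<and> G \<in> rees_algebra v"
proof -
  have "0 \<in> rees_ideal \<nu>"
    by (simp add: rees_ideal_def zero_mem_val_gt[OF val_\<nu>])
  then show ?thesis
    using assms unfolding stable_rees_algebra_def limit_class_def by force
qed

text \<open>
  Addition and multiplication in the direct limit have the same shape. The result does not depend
  on representatives because congruence modulo \<open>I\<^sub>\<nu>\<close> is compatible with the operations, the graded
  ring of \<open>\<nu>\<close> being presented by \<open>S\<^sub>\<nu>\<close>.
\<close>

lemma limit_class_operation:
  assumes F: "F \<in> stable_rees_algebra" and G: "G \<in> stable_rees_algebra"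
    and op_mem: "\<And>F G. F \<in> stable_rees_algebra \<Longrightarrow> G \<in> stable_rees_algebra \<Longrightarrow> op F G \<in> stable_rees_algebra"
    and op_mem': "\<And>k F G. k \<in> V \<Longrightarrow> F \<in> rees_algebra k \<Longrightarrow> G \<in> rees_algebra k \<Longrightarrow> op F G \<in> rees_algebra k"
    and op_hom: "\<And>k F G. k \<in> V \<Longrightarrow> F \<in> rees_algebra k \<Longrightarrow> G \<in> rees_algebra k \<Longrightarrow>
      opk k (graded_class k F) (graded_class k G) = graded_class k (op F G)"
    and op_\<nu>: "\<And>F G. F \<in> rees_algebra \<nu> \<Longrightarrow> G \<in> rees_algebra \<nu> \<Longrightarrow>
      op\<nu> (graded_class \<nu> F) (graded_class \<nu> G) = graded_class \<nu> (op F G)"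
  shows "(\<Union>(i, x)\<in>limit_class F. \<Union>(j, y)\<in>limit_class G. \<Union>k\<in>{k \<in> V. i \<le> k \<and> j \<le> k}.
    direct_limit_class V graded_ring graded_map k (opk k (graded_map i k x) (graded_map j k y)))
    = limit_class (op F G)" (is "?L = _")
proof -
  have *: "direct_limit_class V graded_ring graded_map k (opk k (graded_map i k x) (graded_map j k y))
      = limit_class (op F G)"
    if x: "(i, x) \<in> limit_class F" and y: "(j, y) \<in> limit_class G" and k: "k \<in> V" "i \<le> k" "j \<le> k"
    for i x j y k
  proof -
    obtain F' where F': "i \<in> V" "x = graded_class i F'" "F' \<in> rees_algebra i" "F' - F \<in> rees_ideal \<nu>"
      using x by (auto simp: limit_class_def)
    obtain G' where G': "j \<in> V" "y = graded_class j G'" "G' \<in> rees_algebra j" "G' - G \<in> rees_ideal \<nu>"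
      using y by (auto simp: limit_class_def)
    have k': "F' \<in> rees_algebra k" "G' \<in> rees_algebra k"
      using F' G' k rees_algebra_mono by blast+
    have T: "F' \<in> stable_rees_algebra" "G' \<in> stable_rees_algebra"
      using F' G' by (auto simp: stable_rees_algebra_def)
    have "graded_class \<nu> F' = graded_class \<nu> F" "graded_class \<nu> G' = graded_class \<nu> G"
      using T F G F' G' subset_\<nu> graded_class_eq_iff[OF val_\<nu>] by blast+
    then have "graded_class \<nu> (op F' G') = graded_class \<nu> (op F G)"
      using op_\<nu> T F G subset_\<nu> by (metis subsetD)
    then have "limit_class (op F' G') = limit_class (op F G)"
      using T F G op_mem limit_class_eq_iff by blast
    moreover have "direct_limit_class V graded_ring graded_map k (opk k (graded_map i k x) (graded_map j k y))
        = limit_class (op F' G')"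
      using F' G' k k' op_hom op_mem' by (simp add: graded_map_class direct_limit_class_eq)
    ultimately show ?thesis by simp
  qed
  obtain i x j y where xy: "(i, x) \<in> limit_class F" "i \<in> V" "(j, y) \<in> limit_class G" "j \<in> V"
    using limit_class_nonempty[OF F] limit_class_nonempty[OF G] by blast
  then obtain k where "k \<in> V" "i \<le> k" "j \<le> k"
    using common_upper by blast
  then have "limit_class (op F G) \<subseteq> ?L"
    using xy *[OF xy(1) xy(3)] by blast
  moreover have "?L \<subseteq> limit_class (op F G)"
    using * by blast
  ultimately show ?thesis by blast
qed

lemma direct_limit_presentation:
  "ring_presentation stable_rees_algebra limit_class (direct_limit V graded_ring graded_map)"
proof
  let ?L = "direct_limit V graded_ring graded_map"
  show "carrier ?L = limit_class ` stable_rees_algebra"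
  proof -
    have "carrier ?L = (\<Union>v\<in>V. \<Union>x\<in>carrier (graded_ring v). {direct_limit_class V graded_ring graded_map v x})"
      by (auto simp: direct_limit_def quotient_def direct_limit_class_def)
    also have "\<dots> = (\<Union>v\<in>V. \<Union>F\<in>rees_algebra v. {limit_class F})"
      using ring_presentation.carrier_eq[OF presentation] direct_limit_class_eq by simp
    finally show ?thesis
      by (auto simp: stable_rees_algebra_def)
  qed
  show "\<zero>\<^bsub>?L\<^esub> = limit_class 0"
    using nonempty ring_presentation.hom_zero[OF presentation] ring_presentation.zero_mem[OF presentation]
    by (simp add: direct_limit_def direct_limit_class_eq)
  show "\<one>\<^bsub>?L\<^esub> = limit_class 1"
    using nonempty ring_presentation.hom_one[OF presentation] ring_presentation.one_mem[OF presentation]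
    by (simp add: direct_limit_def direct_limit_class_eq)
  show "limit_class F \<oplus>\<^bsub>?L\<^esub> limit_class G = limit_class (F + G)"
    if "F \<in> stable_rees_algebra" "G \<in> stable_rees_algebra" for F G
    using limit_class_operation[OF that, of "(+)" "\<lambda>k. add (graded_ring k)" "add (graded_ring \<nu>)"]
      ring_closed ring_presentation.add_mem[OF presentation] ring_presentation.hom_add[OF presentation]
      top.hom_add
    by (simp add: direct_limit_def)
  show "limit_class F \<otimes>\<^bsub>?L\<^esub> limit_class G = limit_class (F * G)"
    if "F \<in> stable_rees_algebra" "G \<in> stable_rees_algebra" for F G
    using limit_class_operation[OF that, of "(*)" "\<lambda>k. monoid.mult (graded_ring k)" "monoid.mult (graded_ring \<nu>)"]
      ring_closed ring_presentation.mult_mem[OF presentation] ring_presentation.hom_mult[OF presentation]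
      top.hom_mult
    by (simp add: direct_limit_def)
qed (use ring_closed in auto)

lemma direct_limit_iso_stable_subring:
  "direct_limit V graded_ring graded_map \<simeq> graded_ring \<nu>\<lparr>carrier := stable_subring V \<nu>\<rparr>"
  using direct_limit_presentation stable_subring_presentation limit_class_eq_iff
  by (rule presentations_iso)

end

theorem theorem4p7:
  fixes \<nu>\<^sub>0 :: "'k::field \<Rightarrow> 'g::divisible_linordered_ab_group_add with_infinity"
    and V :: "('k poly \<Rightarrow> 'g with_infinity) set"
    and \<nu> :: "'k poly \<Rightarrow> 'g with_infinity"
  assumes "valuation \<nu>\<^sub>0" and "supp \<nu>\<^sub>0 = {0}"
    and "V \<subseteq> extensions \<nu>\<^sub>0" and "V \<noteq> {}"
    and "\<forall>\<mu>\<in>V. \<forall>\<rho>\<in>V. \<mu> \<le> \<rho> \<or> \<rho> \<le> \<mu>"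
    and "\<nu> \<in> extensions \<nu>\<^sub>0" and "\<forall>\<mu>\<in>V. \<mu> \<le> \<nu>"
    and "\<forall>\<mu>\<in>V. (\<forall>\<rho>\<in>V. \<rho> \<le> \<mu>) \<longrightarrow> \<mu> = \<nu>"
  shows "subring (stable_subring V \<nu>) (graded_ring \<nu>) \<and>
    cring (direct_limit V graded_ring graded_map) \<and>
    cring (graded_ring \<nu>\<lparr>carrier := stable_subring V \<nu>\<rparr>) \<and>
    direct_limit V graded_ring graded_map \<simeq> graded_ring \<nu>\<lparr>carrier := stable_subring V \<nu>\<rparr>"
proof -
  interpret valuation_chain V \<nu>
  proof
    show "\<exists>v\<in>V. v f = \<nu> f" if "stable V f" for f
      using assms(3,5-8) that by (rule stable_value_eq)
  qed (use assms in \<open>auto simp: extensions_def\<close>)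
  show ?thesis
    using subring_image ring_presentation.presented_cring[OF direct_limit_presentation]
      ring_presentation.presented_cring[OF stable_subring_presentation]
      direct_limit_iso_stable_subring
    by (simp add: stable_subring_eq)
qed

end
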